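(* Let $d\ge1$ and let $\{\mathbf{Y}_n\}_{n\ge 0}$ be an $\mathcal{S}_d^{+}$-valued supermartingale with respect to a filtration $\{\mathcal{F}_n\}_{n\ge 0}$. Then for any deterministic $\mathbf{A}\in\mathcal{S}_d^{++}$, $$\mathbb{P}(\exists n\ge 0,\ \mathbf{Y}_n\not\preceq\mathbf{A})\le \mathrm{tr}\big((\mathbb{E}\,\mathbf{Y}_0)\mathbf{A}^{-1}\big);$$ or, equivalently, for any stopping time $\tau$ (possibly infinite) with respect to $\{\mathcal{F}_n\}$, $$\mathbb{P}(\mathbf{Y}_\tau\not\preceq\mathbf{A})\le \mathrm{tr}\big((\mathbb{E}\,\mathbf{Y}_0)\mathbf{A}^{-1}\big).$$
   Context: $\mathcal{S}_d$ is the set of real symmetric $d\times d$ matrices, $\mathcal{S}_d^{+}$ the subset of positive semidefinite ones, $\mathcal{S}_d^{++}$ the subset of positive definite ones. $\preceq$ is the Loewner order: $\mathbf{A}\preceq\mathbf{B}$ iff $\mathbf{B}-\mathbf{A}$ is positive semidefinite; $\mathbf{A}\not\preceq\mathbf{B}$ is its negation. Expectations and conditional expectations of random matrices are entrywise. An $\mathcal{S}_d$-valued (integrable) process $\{\mathbf{Y}_n\}_{n\ge 0}$ adapted to a filtration $\{\mathcal{F}_n\}_{n\ge 0}$ is a supermartingale if $\mathbb{E}(\mathbf{Y}_n\mid\mathcal{F}_{n-1})\preceq\mathbf{Y}_{n-1}$ almost surely for all $n\ge 1$. Every $\mathcal{S}_d^+$-valued supermartingale converges almost surely; on $\{\tau=\infty\}$,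 $\mathbf{Y}_\tau$ denotes the almost sure limit $\mathbf{Y}_\infty=\lim_{n\to\infty}\mathbf{Y}_n$. *)

theory Defs
  imports "HOL-Probability.Probability"
begin

definition sym_mats :: "(real^'n^'n) set" where
  "sym_mats = {A. transpose A = A}"

definition psd_mats :: "(real^'n^'n) set" where
  "psd_mats = {A \<in> sym_mats. \<forall>x. 0 \<le> x \<bullet> (A *v x)}"

definition pd_mats :: "(real^'n^'n) set" where
  "pd_mats = {A \<in> sym_mats. \<forall>x. x \<noteq> 0 \<longrightarrow> 0 < x \<bullet> (A *v x)}"

definition loewner_le :: "real^'n^'n \<Rightarrow> real^'n^'n \<Rightarrow> bool"  (infix \<open>\<preceq>\<close> 50) where
  "A \<preceq> B \<longleftrightarrow> B - A \<in> psd_mats"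

definition mat_integrable :: "'a measure \<Rightarrow> ('a \<Rightarrow> real^'n^'n) \<Rightarrow> bool" where
  "mat_integrable M X \<longleftrightarrow> (\<forall>i j. integrable M (\<lambda>\<omega>. X \<omega> $ i $ j))"

definition mat_expectation :: "'a measure \<Rightarrow> ('a \<Rightarrow> real^'n^'n) \<Rightarrow> real^'n^'n" where
  "mat_expectation M X = (\<chi> i j. \<integral>\<omega>. X \<omega> $ i $ j \<partial>M)"

definition mat_cond_exp ::
    "'a measure \<Rightarrow> 'a measure \<Rightarrow> ('a \<Rightarrow> real^'n^'n) \<Rightarrow> 'a \<Rightarrow> real^'n^'n" where
  "mat_cond_exp M G X \<omega> = (\<chi> i j. real_cond_exp M G (\<lambda>\<omega>'. X \<omega>' $ i $ j) \<omega>)"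

definition prob_filtration :: "'a measure \<Rightarrow> (nat \<Rightarrow> 'a measure) \<Rightarrow> bool" where
  "prob_filtration M F \<longleftrightarrow> filtration (space M) F \<and> (\<forall>n. subalgebra M (F n))"

definition mat_supermartingale ::
    "'a measure \<Rightarrow> (nat \<Rightarrow> 'a measure) \<Rightarrow> (nat \<Rightarrow> 'a \<Rightarrow> real^'n^'n) \<Rightarrow> bool" where
  "mat_supermartingale M F Y \<longleftrightarrow>
     (\<forall>n. \<forall>\<omega>\<in>space M. Y n \<omega> \<in> sym_mats) \<and>
     (\<forall>n. Y n \<in> borel_measurable (F n)) \<and>
     (\<forall>n. mat_integrable M (Y n)) \<and>
     (\<forall>n\<ge>1. AE \<omega> in M. mat_cond_exp M (F (n - 1)) (Y n) \<omega> \<preceq> Y (n - 1) \<omega>)"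

text \<open>The library's \<open>stopping_time\<close> requires the values of the time to lie in the index type of
  the filtration; here the index is \<open>nat\<close> and the time may in addition be \<open>\<infinity>\<close>.\<close>

definition ext_stopping_time :: "(nat \<Rightarrow> 'a measure) \<Rightarrow> ('a \<Rightarrow> enat) \<Rightarrow> bool" where
  "ext_stopping_time F \<tau> \<longleftrightarrow> (\<forall>n. Measurable.pred (F n) (\<lambda>\<omega>. \<tau> \<omega> \<le> enat n))"

text \<open>Where the sequence \<open>Y n \<omega>\<close> diverges, \<open>lim\<close> is a fixed unspecified matrix that does not
  depend on \<open>\<omega>\<close>. Hence the value at time \<open>\<infinity>\<close> is measurable everywhere, and it is a version of
  the almost sure limit whenever the process converges almost surely.\<close>

definition stopped_value :: "(nat \<Rightarrow> 'a \<Rightarrow> real^'n^'n) \<Rightarrow> ('a \<Rightarrow> enat) \<Rightarrow> 'a \<Rightarrow> real^'n^'n" where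
  "stopped_value Y \<tau> \<omega> =
     (case \<tau> \<omega> of enat n \<Rightarrow> Y n \<omega> | \<infinity> \<Rightarrow> lim (\<lambda>n. Y n \<omega>))"

end

theory Submission
  imports Defs
begin

text \<open>If \<open>Y\<close> is positive semidefinite and \<open>trace (Y ** matrix_inv A) \<le> 1\<close>, then \<open>Y \<preceq> A\<close>. The
  traces \<open>trace (Y n ** matrix_inv A)\<close> form a nonnegative real supermartingale, so Ville's
  inequality at level 1 gives the first bound. The quadratic forms of \<open>Y n\<close> are nonnegative real
  supermartingales too; by the upcrossing inequality they converge almost surely, hence so does
  \<open>Y n\<close>. Its limit is \<open>\<preceq> A\<close> if all \<open>Y n\<close> are, which covers the time \<open>\<infinity>\<close>.\<close>

section \<open>Positive semidefinite matrices\<close>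

lemma sym_mats_inner_commute:
  fixes A :: "real^'n^'n"
  assumes "A \<in> sym_mats"
  shows "x \<bullet> (A *v y) = y \<bullet> (A *v x)"
  using assms unfolding sym_mats_def
  by (metis (mono_tags) dot_lmul_matrix inner_commute mem_Collect_eq transpose_matrix_vector)

lemma sym_mats_nth_commute: "A \<in> sym_mats \<Longrightarrow> A $ i $ j = A $ j $ i"
  unfolding sym_mats_def transpose_def by (metis (mono_tags) mem_Collect_eq vec_lambda_beta)

lemma quad_form_add_scaleR:
  fixes A :: "real^'n^'n"
  assumes "A \<in> sym_mats"
  shows "(x + t *\<^sub>R y) \<bullet> (A *v (x + t *\<^sub>R y)) =
    x \<bullet> (A *v x) + 2 * t * (x \<bullet> (A *v y)) + t\<^sup>2 * (y \<bullet> (A *v y))"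
  using sym_mats_inner_commute[OF assms, of y x]
  by (simp add: matrix_vector_right_distrib matrix_vector_mult_scaleR inner_simps
      algebra_simps power2_eq_square)

text \<open>The form along the line \<open>x + t *\<^sub>R y\<close> is a nonnegative quadratic
  polynomial in \<open>t\<close>. Since \<open>A\<close> is only semidefinite, its leading
  coefficient may vanish, which is a separate case.\<close>

lemma psd_mats_Cauchy_Schwarz:
  fixes A :: "real^'n^'n"
  assumes "A \<in> psd_mats"
  shows "(x \<bullet> (A *v y))\<^sup>2 \<le> (x \<bullet> (A *v x)) * (y \<bullet> (A *v y))"
proof -
  let ?a = "y \<bullet> (A *v y)" and ?b = "x \<bullet> (A *v y)" and ?c = "x \<bullet> (A *v x)"
  have sym: "A \<in> sym_mats" and nonneg: "\<And>z. 0 \<le> z \<bullet> (A *v z)"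
    using assms by (auto simp: psd_mats_def)
  have form: "0 \<le> ?c + 2 * t * ?b + t\<^sup>2 * ?a" for t
    using nonneg[of "x + t *\<^sub>R y"] quad_form_add_scaleR[OF sym] by simp
  show ?thesis
  proof (cases "?a = 0")
    case True
    have "?b = 0"
    proof (rule ccontr)
      assume "?b \<noteq> 0"
      then show False
        \<comment> \<open>The polynomial is affine here, and this \<open>t\<close> gives it the
          value -1.\<close>
        using form[of "- (?c + 1) / (2 * ?b)"] True by (simp add: field_simps)
    qed
    then show ?thesis by (simp add: True)
  next
    case False
    with nonneg[of y] have "0 < ?a" by linarith
    then show ?thesis
      \<comment> \<open>The minimizer of the quadratic polynomial.\<close>
      using form[of "- ?b / ?a"] by (simp add: field_simps power2_eq_square)
  qed
qed

section \<open>Rank-one matrices and traces of products\<close>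

text \<open>The rank-one matrix of \<open>v\<close> times its transpose. It makes quadratic forms a
  special case of traces of products.\<close>

definition outer :: "real^'n \<Rightarrow> real^'n^'n" where
  "outer v = (\<chi> i j. v $ i * v $ j)"

lemma outer_mult_vec: "outer v *v x = (v \<bullet> x) *\<^sub>R v"
  by (simp add: outer_def vec_eq_iff matrix_vector_mult_def inner_vec_def sum_distrib_left
      sum_distrib_right ac_simps)

lemma outer_psd_mats: "outer v \<in> psd_mats"
  by (simp add: psd_mats_def sym_mats_def outer_mult_vec inner_commute)
    (simp add: outer_def transpose_def vec_eq_iff mult.commute)

lemma trace_mult_outer: "trace (A ** outer v) = v \<bullet> (A *v v)" for A :: "real^'n^'n"
  by (simp add: trace_def matrix_matrix_mult_def outer_def inner_vec_def matrix_vector_mult_def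
      sum_distrib_left ac_simps)

lemma trace_scaleR: "trace (c *\<^sub>R A) = c * trace A" for A :: "real^'n^'n"
  by (simp add: trace_def sum_distrib_left)

text \<open>One step of the Cholesky factorization of \<open>Q\<close>: subtracting a multiple of \<open>outer (row i Q)\<close>
  from \<open>Q\<close> clears row \<open>i\<close> and keeps \<open>Q\<close> positive semidefinite.\<close>

lemma trace_mult_psd_nonneg:
  fixes P Q :: "real^'n^'n"
  assumes "P \<in> psd_mats" "Q \<in> psd_mats"
  shows "0 \<le> trace (P ** Q)"
  using assms(2)
\<comment> \<open>Induction on the number of nonzero rows, which each elimination step
  lowers.\<close>
proof (induction "card {i. Q $ i \<noteq> 0}" arbitrary: Q rule: less_induct)
  case less
  have sym: "Q \<in> sym_mats" and nonneg: "\<And>z. 0 \<le> z \<bullet> (Q *v z)"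
    using less.prems by (auto simp: psd_mats_def)
  show ?case
  proof (cases "Q = 0")
    case True
    then show ?thesis by (simp add: trace_def)
  next
    case False
    then obtain i where i: "Q $ i \<noteq> 0" by (auto simp: vec_eq_iff)
    \<comment> \<open>The pivot is \<open>q\<close>, and \<open>v\<close> is column
      \<open>i\<close>, which equals row \<open>i\<close> by symmetry. \<open>Q'\<close> is the
      Schur complement of the pivot, padded with a zero row and column.\<close>
    define e :: "real^'n" where "e = axis i 1"
    define v where "v = Q *v e"
    define q where "q = Q $ i $ i"
    define Q' where "Q' = Q - (1 / q) *\<^sub>R outer v"
    have v: "v $ j = Q $ j $ i" for j
      by (simp add: v_def e_def matrix_vector_mul_component inner_axis)
    have q: "e \<bullet> (Q *v e) = q"
      using v[of i] by (simp add: q_def v_def e_def inner_axis')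
    \<comment> \<open>This is used twice: a zero pivot would force the whole row \<open>i\<close> to
      vanish, and the subtracted rank-one form never exceeds the form of \<open>Q\<close>.\<close>
    have CS: "(v \<bullet> x)\<^sup>2 \<le> (x \<bullet> (Q *v x)) * q" for x
      using psd_mats_Cauchy_Schwarz[OF less.prems, of x e] q by (simp add: v_def inner_commute)
    have "0 \<le> q" using nonneg[of e] q by simp
    moreover have "q \<noteq> 0"
    proof
      assume "q = 0"
      with CS[of v] have "v = 0" by simp
      then have "Q $ i $ j = 0" for j
        using v[of j] sym_mats_nth_commute[OF sym, of i j] by simp
      with i show False by (simp add: vec_eq_iff)
    qed
    ultimately have "0 < q" by simp
    have "Q' \<in> sym_mats"
      using sym outer_psd_mats[of v]
      by (simp add: Q'_def psd_mats_def sym_mats_def transpose_def vec_eq_iff)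
    moreover have "0 \<le> x \<bullet> (Q' *v x)" for x
      using CS[of x] \<open>0 < q\<close>
      by (simp add: Q'_def matrix_vector_mult_diff_rdistrib scaleR_matrix_vector_assoc[symmetric]
          outer_mult_vec inner_simps inner_commute[of x v] field_simps power2_eq_square)
    ultimately have Q': "Q' \<in> psd_mats" by (simp add: psd_mats_def)
    have nth: "Q' $ j $ k = Q $ j $ k - Q $ j $ i * Q $ k $ i / q" for j k
      by (simp add: Q'_def outer_def v)
    have "Q' $ i $ k = 0" for k
      using \<open>0 < q\<close> sym_mats_nth_commute[OF sym, of k i] by (simp add: nth q_def[symmetric])
    then have "Q' $ i = 0" by (simp add: vec_eq_iff)
    moreover have "Q' $ j = 0" if "Q $ j = 0" for j
      using that by (simp add: vec_eq_iff nth)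
    ultimately have "{j. Q' $ j \<noteq> 0} \<subset> {j. Q $ j \<noteq> 0}" using i by auto
    then have "card {j. Q' $ j \<noteq> 0} < card {j. Q $ j \<noteq> 0}" by (intro psubset_card_mono) auto
    from less.hyps[OF this Q'] have "0 \<le> trace (P ** Q')" .
    moreover have "trace (P ** Q) = trace (P ** Q') + (1 / q) * (v \<bullet> (P *v v))"
    proof -
      have "Q = Q' + (1 / q) *\<^sub>R outer v" by (simp add: Q'_def)
      then have "trace (P ** Q) = trace (P ** Q' + (1 / q) *\<^sub>R (P ** outer v))"
        by (simp add: matrix_add_ldistrib matrix_scalar_ac scalar_matrix_assoc[symmetric])
      then show ?thesis by (simp add: trace_add trace_scaleR trace_mult_outer)
    qed
    moreover have "0 \<le> v \<bullet> (P *v v)" using assms(1) by (simp add: psd_mats_def)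
    ultimately show ?thesis using \<open>0 < q\<close> by simp
  qed
qed

section \<open>Inverses of positive definite matrices\<close>

lemma pd_mats_subset_psd_mats: "pd_mats \<subseteq> psd_mats"
proof
  fix A :: "real^'n^'n" assume A: "A \<in> pd_mats"
  have "0 \<le> x \<bullet> (A *v x)" for x
    using A by (cases "x = 0") (auto simp: pd_mats_def intro: order.strict_implies_order)
  with A show "A \<in> psd_mats" by (simp add: pd_mats_def psd_mats_def)
qed

text \<open>Definiteness forces a trivial kernel, so \<open>A\<close> is invertible and the choice
  in \<open>matrix_inv\<close> yields a genuine inverse.\<close>

lemma pd_mats_matrix_inv:
  fixes A :: "real^'n^'n"
  assumes "A \<in> pd_mats"
  shows "A ** matrix_inv A = mat 1"
proof -
  have "x = 0" if "A *v x = 0" for x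
    using assms that by (force simp: pd_mats_def)
  then have "invertible A"
    using matrix_left_invertible_ker[of A] by (auto simp: invertible_left_inverse)
  then show ?thesis
    unfolding invertible_def matrix_inv_def by (rule someI2_ex) simp
qed

lemma pd_mats_inv_vec:
  fixes A :: "real^'n^'n"
  assumes "A \<in> pd_mats"
  shows "A *v (matrix_inv A *v x) = x"
  by (simp add: matrix_vector_mul_assoc pd_mats_matrix_inv[OF assms])

text \<open>The transpose of a right inverse of the symmetric \<open>A\<close> is a left inverse, so
  the two coincide. The form of the inverse at \<open>x\<close> is the form of \<open>A\<close> at
  \<open>matrix_inv A *v x\<close>.\<close>

lemma matrix_inv_psd_mats:
  fixes A :: "real^'n^'n"
  assumes "A \<in> pd_mats"
  shows "matrix_inv A \<in> psd_mats"
proof -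
  let ?B = "matrix_inv A"
  have A: "A \<in> psd_mats" using assms pd_mats_subset_psd_mats by blast
  have "A ** ?B = mat 1" by (rule pd_mats_matrix_inv[OF assms])
  moreover have "transpose ?B ** A = mat 1"
    using arg_cong[OF calculation, of transpose] A
    by (simp add: matrix_transpose_mul psd_mats_def sym_mats_def)
  ultimately have "transpose ?B = ?B"
    by (metis matrix_mul_assoc matrix_mul_lid matrix_mul_rid)
  then have "?B \<in> sym_mats" by (simp add: sym_mats_def)
  moreover have "0 \<le> x \<bullet> (?B *v x)" for x
    using A pd_mats_inv_vec[OF assms, of x] unfolding psd_mats_def
    by (metis (mono_tags, lifting) inner_commute mem_Collect_eq)
  ultimately show ?thesis by (simp add: psd_mats_def)
qed

text \<open>By Cauchy--Schwarz for the form of \<open>A\<close>, the matrix \<open>outer x\<close> is dominated by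
  \<open>(x \<bullet> (A *v x)) *\<^sub>R matrix_inv A\<close>.\<close>

lemma quad_form_le_trace_mult_inv:
  fixes A Y :: "real^'n^'n"
  assumes "A \<in> pd_mats" "Y \<in> psd_mats"
  shows "x \<bullet> (Y *v x) \<le> trace (Y ** matrix_inv A) * (x \<bullet> (A *v x))"
proof -
  let ?B = "matrix_inv A"
  define D where "D = (x \<bullet> (A *v x)) *\<^sub>R ?B - outer x"
  have A: "A \<in> psd_mats" using assms(1) pd_mats_subset_psd_mats by blast
  have B: "?B \<in> psd_mats" by (rule matrix_inv_psd_mats[OF assms(1)])
  have "D \<in> sym_mats"
    using B outer_psd_mats[of x]
    by (simp add: D_def psd_mats_def sym_mats_def transpose_def vec_eq_iff)
  moreover have "0 \<le> y \<bullet> (D *v y)" for y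
  proof -
    \<comment> \<open>The second vector \<open>?B *v y\<close> turns the \<open>A\<close>-pairing
      with \<open>x\<close> into \<open>x \<bullet> y\<close>.\<close>
    have "(x \<bullet> y)\<^sup>2 \<le> (x \<bullet> (A *v x)) * (y \<bullet> (?B *v y))"
      using psd_mats_Cauchy_Schwarz[OF A, of x "?B *v y"]
      by (simp add: pd_mats_inv_vec[OF assms(1)] inner_commute)
    then show ?thesis
      by (simp add: D_def matrix_vector_mult_diff_rdistrib scaleR_matrix_vector_assoc[symmetric]
          outer_mult_vec inner_simps inner_commute[of y x] power2_eq_square)
  qed
  ultimately have "D \<in> psd_mats" by (simp add: psd_mats_def)
  then have "0 \<le> trace (Y ** D)" by (rule trace_mult_psd_nonneg[OF assms(2)])
  moreover have "trace (Y ** D) + trace (Y ** outer x) = trace (Y ** (D + outer x))"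
    by (simp only: matrix_add_ldistrib trace_add)
  moreover have "D + outer x = (x \<bullet> (A *v x)) *\<^sub>R ?B" by (simp add: D_def)
  ultimately show ?thesis
    by (simp add: matrix_scalar_ac scalar_matrix_assoc[symmetric] trace_scaleR trace_mult_outer
        mult.commute)
qed

text \<open>This places the matrix event \<open>\<not> Y \<preceq> A\<close> inside the scalar event
  that the trace exceeds 1.\<close>

lemma loewner_le_if_trace_mult_inv_le_1:
  fixes A Y :: "real^'n^'n"
  assumes "A \<in> pd_mats" "Y \<in> psd_mats" "trace (Y ** matrix_inv A) \<le> 1"
  shows "Y \<preceq> A"
proof -
  have A: "A \<in> psd_mats" using assms(1) pd_mats_subset_psd_mats by blast
  have "x \<bullet> (Y *v x) \<le> x \<bullet> (A *v x)" for x
    using quad_form_le_trace_mult_inv[OF assms(1,2), of x] assms(3) A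
      mult_right_mono[OF assms(3), of "x \<bullet> (A *v x)"]
    by (simp add: psd_mats_def)
  then show ?thesis
    using A assms(2)
    by (simp add: loewner_le_def psd_mats_def sym_mats_def transpose_def vec_eq_iff
        matrix_vector_mult_diff_rdistrib inner_simps)
qed

section \<open>Limits of matrices and of their quadratic forms\<close>

lemma closed_psd_mats: "closed (psd_mats :: (real^'n^'n) set)"
proof -
  have "psd_mats = {A :: real^'n^'n. (\<forall>i j. A $ j $ i = A $ i $ j) \<and> (\<forall>x. 0 \<le> x \<bullet> (A *v x))}"
    by (auto simp: psd_mats_def sym_mats_def transpose_def vec_eq_iff)
  also have "closed \<dots>"
  proof (intro closed_Collect_conj closed_Collect_all closed_Collect_eq closed_Collect_le)
    show "continuous_on UNIV (\<lambda>A :: real^'n^'n. x \<bullet> (A *v x))" for x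
      unfolding matrix_vector_mult_def inner_vec_def by (auto intro!: continuous_intros)
  qed (intro continuous_intros)+
  finally show ?thesis .
qed

lemma loewner_le_lim:
  assumes "convergent X" "\<And>n. X n \<preceq> A"
  shows "lim X \<preceq> A"
proof -
  have "X \<longlonglongrightarrow> lim X" using assms(1) by (simp add: convergent_LIMSEQ_iff)
  then have "(\<lambda>n. A - X n) \<longlonglongrightarrow> A - lim X" by (intro tendsto_intros)
  with closed_psd_mats show ?thesis
    using assms(2) unfolding loewner_le_def by (rule_tac closed_sequentially) auto
qed

text \<open>Polarization, by which convergence of quadratic forms gives convergence of
  entries.\<close>

lemma mat_nth_eq_quad_form:
  fixes A :: "real^'n^'n"
  assumes "A \<in> sym_mats"
  shows "A $ i $ j = (let e = axis i 1; f = axis j 1 in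
    ((e + f) \<bullet> (A *v (e + f)) - e \<bullet> (A *v e) - f \<bullet> (A *v f)) / 2)"
proof -
  have "axis i 1 \<bullet> (A *v axis j 1) = A $ i $ j"
    by (simp add: inner_axis inner_commute[of "axis i 1"] matrix_vector_mul_component)
  then show ?thesis
    using quad_form_add_scaleR[OF assms, of "axis i 1" 1 "axis j 1"] by (simp add: Let_def)
qed

lemma convergent_if_quad_forms_convergent:
  fixes X :: "nat \<Rightarrow> real^'n^'n"
  assumes "\<And>n. X n \<in> sym_mats"
    and "\<And>i j. convergent (\<lambda>n. (axis i 1 + axis j 1) \<bullet> (X n *v (axis i 1 + axis j 1)))"
  shows "convergent X"
proof -
  have diag: "convergent (\<lambda>n. axis i 1 \<bullet> (X n *v axis i 1))" for i
  proof -
    \<comment> \<open>For equal indices the test vector is twice a unit vector, hence the factor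
      1/4.\<close>
    have "axis i 1 \<bullet> (X n *v axis i 1)
        = (axis i 1 + axis i 1) \<bullet> (X n *v (axis i 1 + axis i 1)) * (1 / 4)" for n
      using quad_form_add_scaleR[OF assms(1), of "axis i 1" 1 "axis i 1" n] by simp
    then show ?thesis
      using convergent_mult[OF assms(2)[of i i] convergent_const[of "1 / 4"]] by (simp only:)
  qed
  have "convergent (\<lambda>n. X n $ i $ j)" for i j
    by (subst mat_nth_eq_quad_form[OF assms(1)], unfold Let_def divide_inverse)
      (intro convergent_mult convergent_diff convergent_const diag assms(2))
  then have "(\<lambda>n. X n $ i $ j) \<longlonglongrightarrow> lim (\<lambda>n. X n $ i $ j)" for i j
    by (simp add: convergent_LIMSEQ_iff)
  then have "X \<longlonglongrightarrow> (\<chi> i j. lim (\<lambda>n. X n $ i $ j))"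
    by (intro vec_tendstoI) simp
  then show ?thesis by (auto simp: convergent_def)
qed

section \<open>Upcrossings of a real sequence\<close>

text \<open>The state of the strategy that buys below \<open>a\<close> and sells above
  \<open>b\<close>. The recursion makes the state at time \<open>n\<close> depend on
  \<open>z 0\<close> to \<open>z n\<close> only, so adaptedness follows by induction.\<close>

primrec in_upcrossing :: "real \<Rightarrow> real \<Rightarrow> (nat \<Rightarrow> real) \<Rightarrow> nat \<Rightarrow> bool" where
  "in_upcrossing a b z 0 \<longleftrightarrow> z 0 < a"
| "in_upcrossing a b z (Suc n) \<longleftrightarrow>
     (if in_upcrossing a b z n then z (Suc n) \<le> b else z (Suc n) < a)"

primrec upcrossings :: "real \<Rightarrow> real \<Rightarrow> (nat \<Rightarrow> real) \<Rightarrow> nat \<Rightarrow> real" where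
  "upcrossings a b z 0 = 0"
| "upcrossings a b z (Suc n) = upcrossings a b z n +
     (if in_upcrossing a b z n \<and> b < z (Suc n) then 1 else 0)"

lemma upcrossings_nonneg: "0 \<le> upcrossings a b z n"
  by (induction n) auto

lemma incseq_upcrossings: "incseq (upcrossings a b z)"
  by (rule incseq_SucI) simp

lemma in_upcrossing_le: "a < b \<Longrightarrow> in_upcrossing a b z n \<Longrightarrow> z n \<le> b"
  by (cases n) (auto split: if_splits)

lemma in_upcrossing_if_less: "a < b \<Longrightarrow> z n < a \<Longrightarrow> in_upcrossing a b z n"
  by (cases n) auto

text \<open>The state can be left only by completing an upcrossing, which is counted.\<close>

lemma in_upcrossing_imp:
  assumes "in_upcrossing a b z m" "m \<le> n"
  shows "in_upcrossing a b z n \<or> upcrossings a b z m + 1 \<le> upcrossings a b z n"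
  using assms(2)
proof (induction n rule: dec_induct)
  case (step n)
  then show ?case using incseqD[OF incseq_upcrossings step.hyps(1), of a b z] by auto
qed (use assms(1) in simp)

text \<open>After any time, some value below \<open>a\<close> finds an upcrossing open, and a later
  value above \<open>b\<close> finds it completed, so the count grows again.\<close>

lemma upcrossings_unbounded:
  assumes "a < b" "\<exists>\<^sub>F n in sequentially. z n < a" "\<exists>\<^sub>F n in sequentially. b < z n"
  shows "\<exists>n. real K \<le> upcrossings a b z n"
proof (induction K)
  case 0
  show ?case using upcrossings_nonneg by auto
next
  case (Suc K)
  then obtain n where n: "real K \<le> upcrossings a b z n" by blast
  obtain m where m: "n \<le> m" "z m < a"
    using assms(2) by (auto simp: frequently_sequentially)
  obtain p where p: "m \<le> p" "b < z p"
    using assms(3) by (auto simp: frequently_sequentially)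
  have "\<not> in_upcrossing a b z p" using in_upcrossing_le[OF assms(1)] p(2) by force
  then have "upcrossings a b z m + 1 \<le> upcrossings a b z p"
    using in_upcrossing_imp[OF in_upcrossing_if_less[where z = z, OF assms(1) m(2)] p(1)] by blast
  moreover have "upcrossings a b z n \<le> upcrossings a b z m"
    using incseqD[OF incseq_upcrossings m(1)] .
  ultimately have "real (Suc K) \<le> upcrossings a b z p" using n by simp
  then show ?case ..
qed

text \<open>A gap between \<open>liminf\<close> and \<open>limsup\<close> contains rationals
  \<open>a < b\<close> that are crossed infinitely often. Rational levels keep the number of
  exceptional null sets countable later.\<close>

lemma convergent_if_upcrossings_bounded:
  fixes z :: "nat \<Rightarrow> real"
  assumes bounded: "\<And>n. \<bar>z n\<bar> \<le> C"
    and upcrossings: "\<And>a b. a \<in> \<rat> \<Longrightarrow> b \<in> \<rat> \<Longrightarrow> a < b \<Longrightarrow> \<exists>K. \<forall>n. upcrossings a b z n \<le> real K"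
  shows "convergent z"
proof -
  let ?z = "\<lambda>n. ereal (z n)"
  have "liminf ?z = limsup ?z"
  proof (rule ccontr)
    assume "liminf ?z \<noteq> limsup ?z"
    then have "liminf ?z < limsup ?z"
      using Liminf_le_Limsup[of sequentially ?z] by simp
    \<comment> \<open>The levels are arranged as
      \<open>liminf < c' < a < c < b < c'' < limsup\<close>.\<close>
    then obtain c where c: "liminf ?z < ereal c" "ereal c < limsup ?z"
      using ereal_dense2 by blast
    from ereal_dense2[OF c(1)] obtain c' where c': "liminf ?z < ereal c'" "c' < c" by auto
    from Rats_dense_in_real[OF c'(2)] obtain a where a: "a \<in> \<rat>" "c' < a" "a < c" by blast
    from ereal_dense2[OF c(2)] obtain c'' where c'': "ereal c'' < limsup ?z" "c < c''" by auto
    from Rats_dense_in_real[OF c''(2)] obtain b where b: "b \<in> \<rat>" "c < b" "b < c''" by blast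
    have "\<exists>\<^sub>F n in sequentially. z n < a"
    proof (rule ccontr)
      assume "\<not> ?thesis"
      then have "\<forall>\<^sub>F n in sequentially. ereal a \<le> ?z n" by (simp add: not_frequently not_less)
      then have "ereal a \<le> liminf ?z" by (rule Liminf_bounded)
      also have "\<dots> < ereal c'" by (rule c')
      finally show False using a by simp
    qed
    moreover have "\<exists>\<^sub>F n in sequentially. b < z n"
    proof (rule ccontr)
      assume "\<not> ?thesis"
      then have "\<forall>\<^sub>F n in sequentially. ?z n \<le> ereal b" by (simp add: not_frequently not_less)
      then have "limsup ?z \<le> ereal b" by (rule Limsup_bounded)
      with c'' have "ereal c'' < ereal b" by (rule_tac less_le_trans)
      then show False using b by simp
    qed
    moreover have "a < b" using a b by simp
    moreover obtain K where K: "\<And>n. upcrossings a b z n \<le> real K"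
      using upcrossings[OF a(1) b(1) \<open>a < b\<close>] by blast
    ultimately obtain n where "real (Suc K) \<le> upcrossings a b z n"
      using upcrossings_unbounded by blast
    with K[of n] show False by simp
  qed
  then have lim: "?z \<longlonglongrightarrow> limsup ?z"
    by (intro Liminf_eq_Limsup) auto
  \<comment> \<open>So far the limit could be infinite; the bound \<open>C\<close> excludes
    this.\<close>
  have "limsup ?z \<le> ereal C"
    using bounded by (intro LIMSEQ_le_const2[OF lim]) (auto simp: abs_le_iff)
  moreover have "ereal (- C) \<le> limsup ?z"
    using bounded by (intro LIMSEQ_le_const[OF lim]) (auto simp: abs_le_iff minus_le_iff)
  ultimately obtain l where "limsup ?z = ereal l" by (cases "limsup ?z") auto
  with lim have "z \<longlonglongrightarrow> l" by simp
  then show ?thesis by (auto simp: convergent_def)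
qed

section \<open>Nonnegative supermartingales\<close>

locale nonneg_supermartingale = prob_space M for M :: "'a measure" +
  fixes F :: "nat \<Rightarrow> 'a measure" and Z :: "nat \<Rightarrow> 'a \<Rightarrow> real"
  assumes subalg: "subalgebra M (F n)"
    and sets_F_Suc: "sets (F n) \<subseteq> sets (F (Suc n))"
    and adapted: "Z n \<in> borel_measurable (F n)"
    and integrable_Z [simp]: "integrable M (Z n)"
    and nonneg: "\<omega> \<in> space M \<Longrightarrow> 0 \<le> Z n \<omega>"
    and cond_exp_le: "AE \<omega> in M. real_cond_exp M (F n) (Z (Suc n)) \<omega> \<le> Z n \<omega>"
begin

lemma measurable_Z [measurable]: "Z n \<in> borel_measurable M"
  by (rule borel_measurable_integrable) simp

lemma measurable_F_Suc: "f \<in> measurable (F n) N \<Longrightarrow> f \<in> measurable (F (Suc n)) N"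
  using subalg sets_F_Suc[of n]
  by (intro measurable_from_subalg[of "F (Suc n)" "F n"]) (auto simp: subalgebra_def)

text \<open>The 0-1 stake \<open>h\<close> is known at time \<open>n\<close>, so under the integral
  \<open>Z (Suc n)\<close> may be replaced by its conditional expectation, which is almost surely at
  most \<open>Z n\<close>.\<close>

lemma integral_increment_nonpos:
  assumes P: "Measurable.pred (F n) P"
  shows "(\<integral>\<omega>. (if P \<omega> then Z (Suc n) \<omega> - Z n \<omega> else 0) \<partial>M) \<le> 0"
proof -
  interpret finite_measure_subalgebra M "F n"
    by unfold_locales (rule subalg)
  define h :: "'a \<Rightarrow> real" where "h = (\<lambda>\<omega>. if P \<omega> then 1 else 0)"
  have h_F: "h \<in> borel_measurable (F n)" unfolding h_def using P by measurable
  have [measurable]: "h \<in> borel_measurable M" by (rule measurable_from_subalg[OF subalg h_F])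
  have int: "integrable M (\<lambda>\<omega>. h \<omega> * Z k \<omega>)" for k
    by (rule Bochner_Integration.integrable_bound[OF integrable_Z[of k]]) (simp_all, simp add: h_def)
  have "(\<integral>\<omega>. (if P \<omega> then Z (Suc n) \<omega> - Z n \<omega> else 0) \<partial>M)
      = (\<integral>\<omega>. h \<omega> * Z (Suc n) \<omega> - h \<omega> * Z n \<omega> \<partial>M)"
    by (intro Bochner_Integration.integral_cong) (auto simp: h_def)
  also have "\<dots> = (\<integral>\<omega>. h \<omega> * Z (Suc n) \<omega> \<partial>M) - (\<integral>\<omega>. h \<omega> * Z n \<omega> \<partial>M)"
    by (intro Bochner_Integration.integral_diff int)
  also have "(\<integral>\<omega>. h \<omega> * Z (Suc n) \<omega> \<partial>M)
      = (\<integral>\<omega>. h \<omega> * real_cond_exp M (F n) (Z (Suc n)) \<omega> \<partial>M)"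
    by (rule real_cond_exp_intg(2)[OF int h_F, symmetric]) measurable
  also have "\<dots> \<le> (\<integral>\<omega>. h \<omega> * Z n \<omega> \<partial>M)"
  proof (rule integral_mono_AE)
    show "integrable M (\<lambda>\<omega>. h \<omega> * real_cond_exp M (F n) (Z (Suc n)) \<omega>)"
      by (rule real_cond_exp_intg(1)[OF int h_F]) measurable
    show "AE \<omega> in M. h \<omega> * real_cond_exp M (F n) (Z (Suc n)) \<omega> \<le> h \<omega> * Z n \<omega>"
      using cond_exp_le[of n] by eventually_elim (auto simp: h_def)
  qed (rule int)
  finally show ?thesis by simp
qed

text \<open>\<open>W\<close> gains at most what a strategy gains that holds \<open>Z\<close> on the
  events \<open>P n\<close>, and such a gain has nonpositive mean. Domination rather than equality
  lets \<open>W\<close> also discard value.\<close>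

lemma expectation_le_if_increments_le:
  assumes int: "\<And>n. integrable M (W n)"
    and P: "\<And>n. Measurable.pred (F n) (P n)"
    and le: "\<And>n \<omega>. \<omega> \<in> space M \<Longrightarrow>
      W (Suc n) \<omega> - W n \<omega> \<le> (if P n \<omega> then Z (Suc n) \<omega> - Z n \<omega> else 0)"
  shows "expectation (W n) \<le> expectation (W 0)"
proof (induction n)
  case (Suc n)
  have [measurable]: "Measurable.pred M (P n)"
    by (rule measurable_from_subalg[OF subalg P])
  have "integrable M (\<lambda>\<omega>. if P n \<omega> then Z (Suc n) \<omega> - Z n \<omega> else 0)"
    by (rule Bochner_Integration.integrable_bound[of _ "\<lambda>\<omega>. Z (Suc n) \<omega> - Z n \<omega>"]) auto
  then have "expectation (\<lambda>\<omega>. W (Suc n) \<omega> - W n \<omega>)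
      \<le> expectation (\<lambda>\<omega>. if P n \<omega> then Z (Suc n) \<omega> - Z n \<omega> else 0)"
    by (intro integral_mono Bochner_Integration.integrable_diff int le)
  also have "\<dots> \<le> 0" by (rule integral_increment_nonpos[OF P])
  finally show ?case using Suc int by simp
qed simp

text \<open>The process \<open>W\<close> below is \<open>Z\<close> stopped when it first exceeds \<open>c\<close>, with its value then lowered
  to \<open>c\<close>.\<close>

theorem Ville_inequality:
  assumes "0 < c"
  shows "prob {\<omega> \<in> space M. \<exists>k. c < Z k \<omega>} \<le> expectation (Z 0) / c"
proof -
  define hit where "hit n \<omega> \<longleftrightarrow> (\<exists>k\<le>n. c < Z k \<omega>)" for n \<omega>
  define W where "W n \<omega> = (if hit n \<omega> then c else Z n \<omega>)" for n \<omega>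
  have hit_0: "hit 0 \<omega> \<longleftrightarrow> c < Z 0 \<omega>" for \<omega> by (simp add: hit_def)
  have hit_Suc: "hit (Suc n) \<omega> \<longleftrightarrow> hit n \<omega> \<or> c < Z (Suc n) \<omega>" for n \<omega>
    by (auto simp: hit_def le_Suc_eq)
  have hit_F: "Measurable.pred (F n) (hit n)" for n
  proof (induction n)
    case 0
    show ?case unfolding hit_0[abs_def] using adapted[of 0] by measurable
  next
    case (Suc n)
    show ?case
      unfolding hit_Suc[abs_def] using adapted[of "Suc n"] measurable_F_Suc[OF Suc] by measurable
  qed
  have hit_M [measurable]: "Measurable.pred M (hit n)" for n
    by (rule measurable_from_subalg[OF subalg hit_F])
  have W_int: "integrable M (W n)" for n
    unfolding W_def
    by (rule Bochner_Integration.integrable_bound[of _ "\<lambda>\<omega>. c + Z n \<omega>"])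
      (use nonneg assms in \<open>auto intro!: AE_I2\<close>)
  have hit_bound: "prob {\<omega> \<in> space M. hit n \<omega>} \<le> expectation (Z 0) / c" for n
  proof -
    define H where "H = {\<omega> \<in> space M. hit n \<omega>}"
    have H [measurable]: "H \<in> events" unfolding H_def by measurable
    have "c * prob H = expectation (\<lambda>\<omega>. c * indicator H \<omega>)" by simp
    \<comment> \<open>On \<open>H\<close> the two integrands agree; off \<open>H\<close>
      nonnegativity of \<open>Z\<close> suffices.\<close>
    also have "\<dots> \<le> expectation (W n)"
    proof (rule integral_mono[OF _ W_int])
      show "integrable M (\<lambda>\<omega>. c * indicator H \<omega>)"
        using H by (auto simp: less_top[symmetric] intro!: integrable_real_indicator)
    qed (use nonneg in \<open>auto simp: W_def H_def indicator_def\<close>)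
    also have "\<dots> \<le> expectation (W 0)"
      \<comment> \<open>\<open>Z\<close> is held until the hit. At the hit \<open>W\<close> moves to
        \<open>c\<close>, which is below \<open>Z\<close>, and stays there.\<close>
      by (rule expectation_le_if_increments_le[where P = "\<lambda>n \<omega>. \<not> hit n \<omega>"])
        (rule W_int, use hit_F in \<open>auto simp: W_def hit_Suc\<close>)
    also have "\<dots> \<le> expectation (Z 0)"
      by (intro integral_mono W_int) (auto simp: W_def hit_0)
    finally show ?thesis using assms by (simp add: H_def field_simps)
  qed
  have "(\<lambda>n. prob {\<omega> \<in> space M. hit n \<omega>}) \<longlonglongrightarrow> prob (\<Union>n. {\<omega> \<in> space M. hit n \<omega>})"
    by (rule finite_Lim_measure_incseq) (auto simp: incseq_def hit_def intro: order_trans)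
  then have "prob (\<Union>n. {\<omega> \<in> space M. hit n \<omega>}) \<le> expectation (Z 0) / c"
    using hit_bound by (intro LIMSEQ_le_const2) auto
  also have "(\<Union>n. {\<omega> \<in> space M. hit n \<omega>}) = {\<omega> \<in> space M. \<exists>k. c < Z k \<omega>}"
    by (auto simp: hit_def)
  finally show ?thesis .
qed

text \<open>By Ville's inequality at the levels \<open>Suc c\<close>, the probability of an
  unbounded path is below every positive number.\<close>

lemma AE_bounded: "AE \<omega> in M. \<exists>C. \<forall>n. \<bar>Z n \<omega>\<bar> \<le> C"
proof -
  define N where "N = {\<omega> \<in> space M. \<forall>c::nat. \<exists>k. real c < Z k \<omega>}"
  have N [measurable]: "N \<in> events" unfolding N_def by measurable
  have "prob N \<le> expectation (Z 0) / real (Suc c)" for c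
  proof -
    have "prob N \<le> prob {\<omega> \<in> space M. \<exists>k. real (Suc c) < Z k \<omega>}"
      unfolding N_def by (intro finite_measure_mono) (blast, measurable)
    also have "\<dots> \<le> expectation (Z 0) / real (Suc c)" by (rule Ville_inequality) simp
    finally show ?thesis .
  qed
  moreover have "(\<lambda>c. expectation (Z 0) / real (Suc c)) \<longlonglongrightarrow> 0"
    by (intro LIMSEQ_Suc lim_const_over_n)
  ultimately have "prob N \<le> 0" by (intro LIMSEQ_le_const) auto
  then have "prob N = 0" using measure_nonneg[of M N] by linarith
  then have "AE \<omega> in M. \<omega> \<notin> N" by (simp add: prob_eq_0)
  then show ?thesis
  proof (rule AE_mp, intro AE_I2 impI)
    fix \<omega> assume \<omega>: "\<omega> \<in> space M" "\<omega> \<notin> N"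
    then obtain c :: nat where "\<And>k. Z k \<omega> \<le> real c" by (auto simp: N_def not_less)
    then show "\<exists>C. \<forall>n. \<bar>Z n \<omega>\<bar> \<le> C" using nonneg[OF \<omega>(1)] by auto
  qed
qed

section \<open>Upcrossings and almost sure convergence\<close>

lemma in_upcrossing_measurable: "Measurable.pred (F n) (\<lambda>\<omega>. in_upcrossing a b (\<lambda>k. Z k \<omega>) n)"
proof (induction n)
  case 0
  show ?case unfolding in_upcrossing.simps using adapted[of 0] by measurable
next
  case (Suc n)
  show ?case
    unfolding in_upcrossing.simps using adapted[of "Suc n"] measurable_F_Suc[OF Suc] by measurable
qed

lemma upcrossings_measurable [measurable]:
  "(\<lambda>\<omega>. upcrossings a b (\<lambda>k. Z k \<omega>) n) \<in> borel_measurable M"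
proof (induction n)
  case (Suc n)
  note [measurable] = Suc measurable_from_subalg[OF subalg in_upcrossing_measurable]
  show ?case unfolding upcrossings.simps by measurable
qed simp

lemma upcrossings_integrable: "integrable M (\<lambda>\<omega>. upcrossings a b (\<lambda>k. Z k \<omega>) n)"
proof (rule integrable_const_bound[of _ "real n"])
  have "upcrossings a b z n \<le> real n" for z by (induction n) auto
  then show "AE \<omega> in M. norm (upcrossings a b (\<lambda>k. Z k \<omega>) n) \<le> real n"
    using upcrossings_nonneg by (auto simp: abs_of_nonneg)
qed measurable

text \<open>The process \<open>W\<close> below is at most the gain of the strategy that holds \<open>Z\<close> during each
  upcrossing, with every completed upcrossing credited only \<open>b - a\<close>.\<close>

lemma upcrossings_inequality:
  assumes "0 \<le> a" "a < b"
  shows "expectation (\<lambda>\<omega>. upcrossings a b (\<lambda>k. Z k \<omega>) n) \<le> a / (b - a)"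
proof -
  define P where "P n \<omega> = in_upcrossing a b (\<lambda>k. Z k \<omega>) n" for n \<omega>
  define u where "u n \<omega> = upcrossings a b (\<lambda>k. Z k \<omega>) n" for n \<omega>
  define W where "W n \<omega> = (b - a) * u n \<omega> + (if P n \<omega> then Z n \<omega> - a else 0)" for n \<omega>
  have P_F: "Measurable.pred (F n) (P n)" for n
    unfolding P_def by (rule in_upcrossing_measurable)
  have [measurable]: "Measurable.pred M (P n)" for n
    by (rule measurable_from_subalg[OF subalg P_F])
  have u_int [simp]: "integrable M (u n)" for n unfolding u_def by (rule upcrossings_integrable)
  have hold_int: "integrable M (\<lambda>\<omega>. if P n \<omega> then Z n \<omega> - a else 0)" for n
    by (rule Bochner_Integration.integrable_bound[of _ "\<lambda>\<omega>. Z n \<omega> - a"]) auto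
  have W_int: "integrable M (W n)" for n
    unfolding W_def using hold_int by simp
  have "(b - a) * expectation (u n) - a = expectation (\<lambda>\<omega>. (b - a) * u n \<omega> - a)"
    by (simp add: prob_space)
  also have "\<dots> \<le> expectation (W n)"
    \<comment> \<open>An open position is worth at least \<open>- a\<close> because \<open>Z\<close>
      is nonnegative; a closed one is worth 0.\<close>
    by (intro integral_mono W_int) (use assms nonneg in \<open>auto simp: W_def\<close>)
  also have "\<dots> \<le> expectation (W 0)"
    \<comment> \<open>Opening a position changes \<open>W\<close> by
      \<open>Z (Suc n) - a < 0\<close>. Completing one changes it by \<open>b - Z n\<close>, less
      than the increment of \<open>Z\<close>.\<close>
    by (rule expectation_le_if_increments_le[where P = P])
      (rule W_int, rule P_F, use assms in \<open>auto simp: W_def P_def u_def algebra_simps\<close>)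
  \<comment> \<open>A position is open at time 0 only if \<open>Z 0 < a\<close>.\<close>
  also have "\<dots> \<le> expectation (\<lambda>_. 0)"
    by (intro integral_mono W_int) (auto simp: W_def P_def u_def)
  finally show ?thesis using assms by (simp add: u_def[abs_def] field_simps)
qed

text \<open>For negative \<open>a\<close> no upcrossing ever opens. Otherwise the expected counts
  are bounded uniformly in \<open>n\<close>, so by monotone convergence the total count has finite
  mean.\<close>

lemma AE_upcrossings_bounded:
  assumes "a < b"
  shows "AE \<omega> in M. \<exists>K. \<forall>n. upcrossings a b (\<lambda>k. Z k \<omega>) n \<le> real K"
proof (cases "0 \<le> a")
  case False
  have "upcrossings a b (\<lambda>k. Z k \<omega>) n = 0" if "\<omega> \<in> space M" for n \<omega>
  proof -
    have "\<not> in_upcrossing a b (\<lambda>k. Z k \<omega>) n" for n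
      by (induction n) (use False nonneg[OF that] in \<open>auto simp: not_less intro: order_trans[of a 0]\<close>)
    then show ?thesis by (induction n) auto
  qed
  then show ?thesis by (intro AE_I2) auto
next
  case True
  define u where "u n \<omega> = upcrossings a b (\<lambda>k. Z k \<omega>) n" for n \<omega>
  have [measurable]: "u n \<in> borel_measurable M" for n
    unfolding u_def by measurable
  have "(\<integral>\<^sup>+\<omega>. (SUP n. ennreal (u n \<omega>)) \<partial>M) = (SUP n. \<integral>\<^sup>+\<omega>. ennreal (u n \<omega>) \<partial>M)"
    using incseq_upcrossings
    by (intro nn_integral_monotone_convergence_SUP)
      (auto simp: incseq_def le_fun_def u_def intro!: ennreal_leI)
  also have "\<dots> \<le> ennreal (a / (b - a))"
    using upcrossings_inequality[OF True assms] upcrossings_integrable upcrossings_nonneg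
    by (intro SUP_least) (simp add: u_def nn_integral_eq_integral ennreal_leI)
  also have "\<dots> < \<infinity>" by simp
  finally have "AE \<omega> in M. (SUP n. ennreal (u n \<omega>)) \<noteq> \<infinity>"
    by (intro nn_integral_PInf_AE) auto
  then show ?thesis
  proof eventually_elim
    case (elim \<omega>)
    then obtain r where r: "(SUP n. ennreal (u n \<omega>)) = ennreal r" "0 \<le> r"
      by (cases "SUP n. ennreal (u n \<omega>)") auto
    have "u n \<omega> \<le> r" for n
    proof -
      have "ennreal (u n \<omega>) \<le> ennreal r" unfolding r(1)[symmetric] by (rule SUP_upper) simp
      then show ?thesis using r(2) by simp
    qed
    moreover obtain K where "r \<le> real K" using real_arch_simple by blast
    ultimately show ?case unfolding u_def by (meson order_trans)
  qed
qed

theorem AE_convergent: "AE \<omega> in M. convergent (\<lambda>n. Z n \<omega>)"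
proof -
  have "AE \<omega> in M. \<forall>a\<in>\<rat>. \<forall>b\<in>\<rat>. a < b \<longrightarrow> (\<exists>K. \<forall>n. upcrossings a b (\<lambda>k. Z k \<omega>) n \<le> real K)"
    using AE_upcrossings_bounded by (simp add: AE_ball_countable countable_rat)
  with AE_bounded show ?thesis
  proof eventually_elim
    case (elim \<omega>)
    then obtain C where "\<And>n. \<bar>Z n \<omega>\<bar> \<le> C" by blast
    then show ?case by (rule convergent_if_upcrossings_bounded) (use elim in blast)
  qed
qed

end

section \<open>Traces of matrix supermartingales\<close>

lemma trace_mult_eq_sum: "trace (A ** B) = (\<Sum>i\<in>UNIV. \<Sum>k\<in>UNIV. A $ i $ k * B $ k $ i)"
  for A B :: "real^'n^'n"
  by (simp add: trace_def matrix_matrix_mult_def)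

lemma integrable_trace_mult:
  "mat_integrable M X \<Longrightarrow> integrable M (\<lambda>\<omega>. trace (X \<omega> ** B))" for B :: "real^'n^'n"
  unfolding mat_integrable_def trace_mult_eq_sum by simp

lemma trace_mat_expectation_mult:
  fixes B :: "real^'n^'n"
  assumes "mat_integrable M X"
  shows "trace (mat_expectation M X ** B) = (\<integral>\<omega>. trace (X \<omega> ** B) \<partial>M)"
  using assms unfolding mat_integrable_def trace_mult_eq_sum mat_expectation_def
  by (simp add: Bochner_Integration.integral_sum)

text \<open>The trace is a finite linear combination of the entries of \<open>X\<close>, and
  conditional expectation is linear almost surely.\<close>

lemma (in sigma_finite_subalgebra) trace_mat_cond_exp_mult:
  fixes X :: "'a \<Rightarrow> real^'n^'n"
  assumes "mat_integrable M X"
  shows "AE \<omega> in M.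
    real_cond_exp M F (\<lambda>\<omega>. trace (X \<omega> ** B)) \<omega> = trace (mat_cond_exp M F X \<omega> ** B)"
proof -
  have int: "integrable M (\<lambda>\<omega>. X \<omega> $ i $ k * B $ k $ i)" for i k
    using assms by (simp add: mat_integrable_def)
  have "AE \<omega> in M. real_cond_exp M F (\<lambda>\<omega>. \<Sum>i\<in>UNIV. \<Sum>k\<in>UNIV. X \<omega> $ i $ k * B $ k $ i) \<omega>
      = (\<Sum>i\<in>UNIV. real_cond_exp M F (\<lambda>\<omega>. \<Sum>k\<in>UNIV. X \<omega> $ i $ k * B $ k $ i) \<omega>)"
    by (intro real_cond_exp_sum Bochner_Integration.integrable_sum int)
  moreover have "AE \<omega> in M. \<forall>i. real_cond_exp M F (\<lambda>\<omega>. \<Sum>k\<in>UNIV. X \<omega> $ i $ k * B $ k $ i) \<omega>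
      = (\<Sum>k\<in>UNIV. real_cond_exp M F (\<lambda>\<omega>. X \<omega> $ i $ k * B $ k $ i) \<omega>)"
    unfolding AE_all_countable by (intro allI real_cond_exp_sum int)
  moreover have "AE \<omega> in M. \<forall>i k. real_cond_exp M F (\<lambda>\<omega>. X \<omega> $ i $ k * B $ k $ i) \<omega>
      = real_cond_exp M F (\<lambda>\<omega>. X \<omega> $ i $ k) \<omega> * B $ k $ i"
    unfolding AE_all_countable
    using assms real_cond_exp_cmult by (simp add: mat_integrable_def mult.commute[of _ "B $ _ $ _"])
  ultimately show ?thesis
    by eventually_elim (simp add: trace_mult_eq_sum mat_cond_exp_def)
qed

text \<open>Pairing with a positive semidefinite \<open>B\<close> is linear and monotone for the
  Loewner order. The choice \<open>matrix_inv A\<close> serves the probability bound, and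
  \<open>outer x\<close> serves convergence.\<close>

lemma nonneg_supermartingale_trace_mult:
  fixes Y :: "nat \<Rightarrow> 'a \<Rightarrow> real^'n^'n"
  assumes "prob_space M" "prob_filtration M F" "mat_supermartingale M F Y"
    and psd: "\<And>n \<omega>. \<omega> \<in> space M \<Longrightarrow> Y n \<omega> \<in> psd_mats"
    and B: "B \<in> psd_mats"
  shows "nonneg_supermartingale M F (\<lambda>n \<omega>. trace (Y n \<omega> ** B))"
proof -
  interpret prob_space M by fact
  have subalg: "subalgebra M (F n)" for n
    using assms(2) by (simp add: prob_filtration_def)
  have int: "mat_integrable M (Y n)" for n
    using assms(3) by (simp add: mat_supermartingale_def)
  show ?thesis
  proof
    fix n
    show "subalgebra M (F n)" by (rule subalg)
    show "sets (F n) \<subseteq> sets (F (Suc n))"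
      using assms(2) by (simp add: prob_filtration_def filtration.sets_F_mono[of "space M"])
    have [measurable]: "Y n \<in> borel_measurable (F n)"
      using assms(3) by (simp add: mat_supermartingale_def)
    have "(\<lambda>A. trace (A ** B)) \<in> borel_measurable borel"
      unfolding trace_mult_eq_sum by (intro borel_measurable_continuous_onI continuous_intros)
    then show "(\<lambda>\<omega>. trace (Y n \<omega> ** B)) \<in> borel_measurable (F n)"
      by measurable
    show "integrable M (\<lambda>\<omega>. trace (Y n \<omega> ** B))"
      by (rule integrable_trace_mult[OF int])
    show "0 \<le> trace (Y n \<omega> ** B)" if "\<omega> \<in> space M" for \<omega>
      by (rule trace_mult_psd_nonneg[OF psd[OF that] B])
    interpret finite_measure_subalgebra M "F n"
      by unfold_locales (rule subalg)
    have "\<forall>m\<ge>1. AE \<omega> in M. mat_cond_exp M (F (m - 1)) (Y m) \<omega> \<preceq> Y (m - 1) \<omega>"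
      using assms(3) by (simp add: mat_supermartingale_def)
    from this[rule_format, of "Suc n"]
    have "AE \<omega> in M. mat_cond_exp M (F n) (Y (Suc n)) \<omega> \<preceq> Y n \<omega>" by simp
    with trace_mat_cond_exp_mult[OF int, of "Suc n" B]
    show "AE \<omega> in M. real_cond_exp M (F n) (\<lambda>\<omega>. trace (Y (Suc n) \<omega> ** B)) \<omega> \<le> trace (Y n \<omega> ** B)"
    proof eventually_elim
      case (elim \<omega>)
      let ?E = "mat_cond_exp M (F n) (Y (Suc n)) \<omega>"
      have "0 \<le> trace ((Y n \<omega> - ?E) ** B)"
        using elim(2) B by (intro trace_mult_psd_nonneg) (simp_all add: loewner_le_def)
      also have "\<dots> = trace (Y n \<omega> ** B) - trace (?E ** B)"
        by (simp add: trace_mult_eq_sum left_diff_distrib sum_subtractf)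
      finally show ?case using elim(1) by simp
    qed
  qed
qed

text \<open>Each quadratic form is the trace against some \<open>outer x\<close>, hence a scalar
  supermartingale. Finitely many test vectors determine all entries.\<close>

lemma AE_convergent_mat_supermartingale:
  fixes Y :: "nat \<Rightarrow> 'a \<Rightarrow> real^'n^'n"
  assumes "prob_space M" "prob_filtration M F" "mat_supermartingale M F Y"
    and psd: "\<And>n \<omega>. \<omega> \<in> space M \<Longrightarrow> Y n \<omega> \<in> psd_mats"
  shows "AE \<omega> in M. convergent (\<lambda>n. Y n \<omega>)"
proof -
  have "AE \<omega> in M. convergent (\<lambda>n. x \<bullet> (Y n \<omega> *v x))" for x
    using nonneg_supermartingale.AE_convergent
      [OF nonneg_supermartingale_trace_mult[OF assms outer_psd_mats[of x]]]
    by (simp add: trace_mult_outer)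
  then have "AE \<omega> in M. \<forall>i j. convergent
      (\<lambda>n. (axis i 1 + axis j 1) \<bullet> (Y n \<omega> *v (axis i 1 + axis j 1)))"
    unfolding AE_all_countable by blast
  with AE_space show ?thesis
  proof eventually_elim
    case (elim \<omega>)
    show ?case
      by (rule convergent_if_quad_forms_convergent)
        (use elim psd[OF elim(1)] in \<open>auto simp: psd_mats_def\<close>)
  qed
qed

theorem theorem3p4:
  fixes M :: "'a measure" and F :: "nat \<Rightarrow> 'a measure"
    and Y :: "nat \<Rightarrow> 'a \<Rightarrow> real^'n^'n" and A :: "real^'n^'n"
  assumes "prob_space M"
    and "prob_filtration M F"
    and "mat_supermartingale M F Y"
    and "\<And>n \<omega>. \<omega> \<in> space M \<Longrightarrow> Y n \<omega> \<in> psd_mats"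
    and "A \<in> pd_mats"
  shows "measure M {\<omega> \<in> space M. \<exists>n. \<not> Y n \<omega> \<preceq> A}
           \<le> trace (mat_expectation M (Y 0) ** matrix_inv A)
       \<and> (\<forall>\<tau>. ext_stopping_time F \<tau> \<longrightarrow>
           measure M {\<omega> \<in> space M. \<not> stopped_value Y \<tau> \<omega> \<preceq> A}
             \<le> trace (mat_expectation M (Y 0) ** matrix_inv A))"
proof -
  define Z where "Z n \<omega> = trace (Y n \<omega> ** matrix_inv A)" for n \<omega>
  define N where "N = {\<omega> \<in> space M. \<exists>n. 1 < Z n \<omega>}"
  interpret nonneg_supermartingale M F Z
    unfolding Z_def
    by (rule nonneg_supermartingale_trace_mult[OF assms(1-4) matrix_inv_psd_mats[OF assms(5)]])
  \<comment> \<open>\<open>N\<close> is the common exceptional event for both bounds: outside it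
    every \<open>Y n \<preceq> A\<close>.\<close>
  have N: "N \<in> events" unfolding N_def by measurable
  have "prob N \<le> expectation (Z 0)" using Ville_inequality[of 1] by (simp add: N_def)
  also have "\<dots> = trace (mat_expectation M (Y 0) ** matrix_inv A)"
    using assms(3) by (simp add: Z_def[abs_def] trace_mat_expectation_mult mat_supermartingale_def)
  finally have bound: "prob N \<le> trace (mat_expectation M (Y 0) ** matrix_inv A)" .
  have le: "Y n \<omega> \<preceq> A" if "\<omega> \<in> space M" "\<omega> \<notin> N" for n \<omega>
    using that assms(4,5) by (intro loewner_le_if_trace_mult_inv_le_1) (auto simp: N_def Z_def not_less)
  have conv: "AE \<omega> in M. convergent (\<lambda>n. Y n \<omega>)"
    by (rule AE_convergent_mat_supermartingale[OF assms(1-3)]) (rule assms(4))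
  have "prob {\<omega> \<in> space M. \<exists>n. \<not> Y n \<omega> \<preceq> A} \<le> prob N"
    using le by (intro finite_measure_mono N) blast
  moreover have "prob {\<omega> \<in> space M. \<not> stopped_value Y \<tau> \<omega> \<preceq> A} \<le> prob N" for \<tau>
  \<comment> \<open>At time \<open>\<infinity>\<close> the value is \<open>lim\<close>, which is the
    true limit only where the path converges, so the inclusion in \<open>N\<close> holds almost
    surely.\<close>
  proof (rule finite_measure_mono_AE[OF _ N])
    show "AE \<omega> in M. \<omega> \<in> {\<omega> \<in> space M. \<not> stopped_value Y \<tau> \<omega> \<preceq> A} \<longrightarrow> \<omega> \<in> N"
      using conv
    proof eventually_elim
      case (elim \<omega>)
      have "stopped_value Y \<tau> \<omega> \<preceq> A" if "\<omega> \<in> space M" "\<omega> \<notin> N"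
        using le[OF that] loewner_le_lim[OF elim] by (simp add: stopped_value_def split: enat.split)
      then show ?case by blast
    qed
  qed
  ultimately show ?thesis using bound by (meson order_trans)
qed

end
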